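(* Suppose that, as $n\to\infty$, $$R(2n)\sim 2C_2\,\frac{n}{\log^2 n}\prod_{\substack{p\mid n\\ p>2}}\frac{p-1}{p-2}.$$ Then $$a(2m)\sim\frac{2C_2\,J(m)\,m}{\log^2 m}$$ as $m\to\infty$.
   Context: $\mathcal P$ is the set of odd primes and $\chi_{\mathcal P}:\mathbb N\to\{0,1\}$ its indicator function. For a positive integer $N$, $R(N)=\sum_{n=1}^{N-1}\chi_{\mathcal P}(n)\chi_{\mathcal P}(N-n)$. For a positive integer $m$, $a(m)=\sum_{d\mid m}R(d)$ (sum over positive divisors); this is the coefficient of $z^m$ in $F_N(z)=\sum_{k=0}^{N-1}\left(\sum_{n=1}^{N-1}\chi_{\mathcal P}(n)z^{kn}\right)^2$ for every $N\ge m$. In products $p$ runs over primes. $C_2=\prod_{p>2}\left(1-\frac1{(p-1)^2}\right)$. For a positive integer $m$, letting $k\ge 0$ be the integer with $2^k\parallel m$, $$J(m)=\left(2-\frac1{2^k}\right)\prod_{\substack{p^\ell\parallel m\\ p>2}}\left(1-\frac2{p^{\ell+1}}\right)\left(1-\frac2p\right)^{-1},$$ where $p^\ell\parallel m$ means $p^\ell\mid m$ but $p^{\ell+1}\nmid m$ (and in the product $\ell\ge1$). *)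

theory Defs
  imports
    "HOL-Analysis.Analysis"
    "HOL-Computational_Algebra.Computational_Algebra"
    "HOL-Library.Landau_Symbols"
begin

definition odd_primes :: "nat set" where
  "odd_primes = {p. prime p \<and> odd p}"

definition chi_P :: "nat \<Rightarrow> nat" where
  "chi_P = indicator odd_primes"

definition goldbach_R :: "nat \<Rightarrow> nat" where
  "goldbach_R N = (\<Sum>n = 1..N - 1. chi_P n * chi_P (N - n))"

definition goldbach_a :: "nat \<Rightarrow> nat" where
  "goldbach_a m = (\<Sum>d | d dvd m. goldbach_R d)"

(* The product over primes p > 2, indexed by all naturals with factor 1 elsewhere. *)
definition C2 :: real where
  "C2 = prodinf (\<lambda>p. if prime p \<and> p > 2 then 1 - 1 / (real p - 1)\<^sup>2 else 1)"

lemma convergent_C2: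
  "convergent_prod (\<lambda>p. if prime p \<and> p > 2 then 1 - 1 / (real p - 1)\<^sup>2 else 1)"
proof -
  let ?g = "\<lambda>p. if prime p \<and> p > 2 then - (1 / (real p - 1)\<^sup>2) else 0"
  have s: "summable (\<lambda>n. 1 / (real n)\<^sup>2)"
    using inverse_power_summable[of 2, where 'a = real] by (simp add: field_simps)
  have "summable (\<lambda>p. norm (?g (Suc p)))"
    by (rule summable_comparison_test'[OF s, of 0]) auto
  hence "summable (\<lambda>p. norm (?g p))"
    by (subst summable_Suc_iff [symmetric])
  hence sg: "summable (\<lambda>p. \<bar>?g p\<bar>)"
    by simp
  have "?g p \<noteq> -1" for p
    using power_one_over[of "real p - 1" 2] by (auto simp: power2_eq_1_iff)
  with sg have "convergent_prod (\<lambda>p. 1 + ?g p)"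
    by (rule summable_imp_convergent_prod_real)
  thus ?thesis by (rule back_subst[where P = convergent_prod]) auto
qed

(* For prime p dividing m, the exponent l with p^l exactly dividing m is multiplicity p m. *)
definition J :: "nat \<Rightarrow> real" where
  "J m = (2 - 1 / 2 ^ multiplicity 2 m) *
     (\<Prod>p | p \<in> prime_factors m \<and> p > 2.
        (1 - 2 / real p ^ (multiplicity p m + 1)) * inverse (1 - 2 / real p))"

end

theory Submission
  imports Defs "HOL-Real_Asymp.Real_Asymp"
begin

text \<open>
  Only even divisors contribute, so \<open>a(2m)\<close> is the sum of \<open>R(2n)\<close> over \<open>n dvd m\<close>. Without the
  logarithm, the conjectured size of \<open>R(2n)\<close> is \<open>2 C\<^sub>2 w(n)\<close> with \<open>w(n)/n\<close> multiplicative, and an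
  Euler product computation gives that \<open>w\<close> sums to \<open>m J(m)\<close> over the divisors of \<open>m\<close>. Divisors
  \<open>n > m\<^bsup>1-\<epsilon>\<^esup>\<close> satisfy \<open>log n \<ge> (1-\<epsilon>) log m\<close>, so there the logarithm may be replaced by
  \<open>log m\<close>. Since \<open>R(2n) \<le> 2n\<close>, the remaining divisors contribute at most \<open>\<tau>(m) 2m\<^bsup>1-\<epsilon>\<^esup>\<close>,
  which is negligible by the divisor bound \<open>\<tau>(m) = O(m\<^bsup>\<epsilon>/2\<^esup>)\<close>.
\<close>

section \<open>Induction over coprime prime powers and factorization of divisor sums\<close>

text \<open>Splitting off the full power of one prime divisor leaves a smaller cofactor. This lets
  multiplicative bounds and identities be checked one local factor at a time.\<close>

lemma coprime_prime_power_induct [consumes 1, case_names one prime_power_mult]: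
  fixes m :: nat
  assumes "m > 0"
    and "P 1"
    and step: "\<And>p k n. prime p \<Longrightarrow> k > 0 \<Longrightarrow> n > 0 \<Longrightarrow> \<not> p dvd n \<Longrightarrow> P n \<Longrightarrow> P (p ^ k * n)"
  shows "P m"
  using \<open>m > 0\<close>
proof (induction m rule: less_induct)
  case (less m)
  show ?case
  proof (cases "m = 1")
    case True
    with \<open>P 1\<close> show ?thesis by simp
  next
    case False
    then obtain p where p: "prime p" "p dvd m"
      using prime_factor_nat by blast
    obtain n where n: "m = p ^ multiplicity p m * n" "\<not> p dvd n"
      using multiplicity_decompose'[of m p] less.prems p(1) not_prime_unit by (metis neq0_conv)
    have k: "multiplicity p m > 0"
      using p less.prems by (simp add: prime_multiplicity_gt_zero_iff)
    have "n > 0" using n less.prems by (cases "n = 0") auto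
    moreover have "1 < p ^ multiplicity p m"
      using k prime_gt_1_nat[OF p(1)] by (intro one_less_power)
    ultimately have "n < m" by (subst n(1)) simp
    with \<open>n > 0\<close> have "P n" using less.IH by simp
    from step[OF p(1) k \<open>n > 0\<close> n(2) this] n(1) show ?thesis by simp
  qed
qed

lemma multiplicity_prime_power_mult:
  fixes p n :: nat
  assumes "prime p" "\<not> p dvd n" "n > 0"
  shows "multiplicity p (p ^ k * n) = k"
  using assms by (intro multiplicity_eqI) auto

lemma multiplicity_other_prime_power_mult:
  fixes p q n :: nat
  assumes "prime p" "prime q" "p \<noteq> q"
  shows "multiplicity q (p ^ k * n) = multiplicity q n"
  using assms primes_dvd_imp_eq
  by (intro multiplicity_prime_elem_times_other) (auto dest: prime_dvd_power)

lemma prime_factors_prime_power_mult: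
  fixes p n :: nat
  assumes "prime p" "n > 0" "k > 0"
  shows "prime_factors (p ^ k * n) = insert p (prime_factors n)"
  using assms
  by (auto simp: in_prime_factors_iff prime_dvd_mult_iff prime_dvd_power_iff primes_dvd_imp_eq)

text \<open>Each divisor is \<open>p ^ j * d\<close> for exactly one pair: \<open>j\<close> is
  recovered as the multiplicity of \<open>p\<close>, and then \<open>d\<close> by
  cancellation.\<close>

lemma sum_divisors_prime_power_mult:
  fixes f :: "nat \<Rightarrow> 'a :: comm_monoid_add"
  assumes p: "prime p" "\<not> p dvd n" and "n > 0"
  shows "(\<Sum>d | d dvd p ^ k * n. f d) = (\<Sum>j\<le>k. \<Sum>d | d dvd n. f (p ^ j * d))"
proof -
  have *: "multiplicity p (p ^ j * d) = j" if "d dvd n" for j d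
    using that assms by (intro multiplicity_prime_power_mult) (auto dest: dvd_trans intro: dvd_pos_nat)
  have "\<exists>j\<le>k. \<exists>d. d dvd n \<and> x = p ^ j * d" if "x dvd p ^ k * n" for x
    using division_decomp[OF that] divides_primepow_nat[OF p(1)] by metis
  hence "{d. d dvd p ^ k * n} = (\<lambda>(j, d). p ^ j * d) ` ({..k} \<times> {d. d dvd n})"
    by (fastforce intro: mult_dvd_mono le_imp_power_dvd)
  moreover have "inj_on (\<lambda>(j, d). p ^ j * d) ({..k} \<times> {d. d dvd n})"
  proof (intro inj_onI; clarify)
    fix j d j' d' assume d: "d dvd n" "d' dvd n" and eq: "p ^ j * d = p ^ j' * d'"
    from *[OF d(1), of j] *[OF d(2), of j'] eq have "j = j'" by simp
    with eq p(1) show "j = j' \<and> d = d'" by (simp add: prime_gt_0_nat)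
  qed
  ultimately show ?thesis
    by (simp add: sum.reindex sum.cartesian_product case_prod_unfold)
qed

section \<open>The divisor bound\<close>

text \<open>Bernoulli gives \<open>1 + k * (q - 1) \<le> q ^ k\<close>; the prefactor makes up for a
  small slope \<open>q - 1\<close>, with a constant independent of \<open>k\<close>.\<close>

lemma linear_le_geometric:
  fixes q :: real
  assumes "q > 1"
  shows "real k + 1 \<le> (1 + 1 / (q - 1)) * q ^ k"
proof -
  have "(1 + 1 / (q - 1)) * (1 + real k * (q - 1)) = real k + 1 + (real k * (q - 1) + 1 / (q - 1))"
    using assms by (simp add: distrib_left distrib_right)
  hence "real k + 1 \<le> (1 + 1 / (q - 1)) * (1 + real k * (q - 1))"
    using assms by simp
  also have "1 + real k * (q - 1) \<le> q ^ k"
    using Bernoulli_inequality[of "q - 1" k] assms by simp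
  finally show ?thesis using assms by (simp add: mult_left_mono)
qed

text \<open>
  The number of divisors of \<open>m\<close> divided by \<open>m\<^bsup>e\<^esup>\<close> is a product of local factors
  \<open>(k + 1) / p\<^bsup>ke\<^esup>\<close>. A factor is at most \<open>1\<close> as soon as \<open>p\<^bsup>e\<^esup> \<ge> 2\<close>, and each of the finitely
  many other primes costs at most the constant \<open>B\<close>.
\<close>

lemma card_divisors_bound:
  fixes e :: real
  assumes "e > 0"
  obtains C where "C > 0" "\<And>m. m > 0 \<Longrightarrow> real (card {d. d dvd m}) \<le> C * real m powr e"
proof -
  \<comment> \<open>\<open>Q\<close> separates the small primes from those with
    \<open>p powr e \<ge> 2\<close>; \<open>B\<close> is the constant of
    \<open>linear_le_geometric\<close> for \<open>q = 2 powr e\<close>, which serves every prime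
    since \<open>p \<ge> 2\<close>.\<close>
  define Q where "Q = nat \<lceil>2 powr (1 / e)\<rceil>"
  define B where "B = 1 + 1 / (2 powr e - 1)"
  have two: "2 powr e > 1" using assms by (simp add: gr_one_powr)
  hence B: "B \<ge> 1" by (simp add: B_def)
  have "real (card {d. d dvd m}) \<le> B ^ card {p \<in> prime_factors m. p < Q} * real m powr e"
    if "m > 0" for m using that
  proof (induction rule: coprime_prime_power_induct)
    case one
    then show ?case by simp
  next
    case (prime_power_mult p k n)
    let ?c = "\<lambda>m. card {p \<in> prime_factors m. p < Q}"
    have p2: "real p \<ge> 2" using prime_ge_2_nat[OF prime_power_mult(1)] by simp
    have fac: "prime_factors (p ^ k * n) = insert p (prime_factors n)"
      using prime_power_mult by (intro prime_factors_prime_power_mult)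
    have pn: "p \<notin> prime_factors n" using prime_power_mult by auto
    have card: "card {d. d dvd p ^ k * n} = (k + 1) * card {d. d dvd n}"
      using sum_divisors_prime_power_mult[OF prime_power_mult(1,4,3), of "\<lambda>_. 1::nat" k]
      by simp
    have pk: "real (p ^ k * n) powr e = (real p powr e) ^ k * real n powr e"
      using p2 by (simp add: powr_mult powr_powr mult.commute flip: powr_realpow)
    \<comment> \<open>The local inequality: the exponent of \<open>B\<close> grows by one exactly
      when the new prime is below \<open>Q\<close>.\<close>
    have main: "(real k + 1) * B ^ ?c n \<le> B ^ ?c (p ^ k * n) * (real p powr e) ^ k"
    proof (cases "p < Q")
      case True
      have "{q \<in> prime_factors (p ^ k * n). q < Q} = insert p {q \<in> prime_factors n. q < Q}"
        using fac True by auto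
      hence c: "?c (p ^ k * n) = Suc (?c n)" using pn by simp
      have "real k + 1 \<le> B * (2 powr e) ^ k"
        unfolding B_def by (rule linear_le_geometric[OF two])
      also have "\<dots> \<le> B * (real p powr e) ^ k"
        using B p2 assms by (intro mult_left_mono power_mono powr_mono2) auto
      finally have "(real k + 1) * B ^ ?c n \<le> (B * (real p powr e) ^ k) * B ^ ?c n"
        using B by (intro mult_right_mono) auto
      thus ?thesis unfolding c by (simp add: mult_ac)
    next
      case False
      have "{q \<in> prime_factors (p ^ k * n). q < Q} = {q \<in> prime_factors n. q < Q}"
        using fac False by auto
      moreover have "2 \<le> real p powr e"
      proof -
        have "2 powr (1 / e) \<le> real Q" unfolding Q_def by (rule real_nat_ceiling_ge)
        also have "\<dots> \<le> real p" using False by simp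
        finally have le: "2 powr (1 / e) \<le> real p" .
        have "2 = (2 powr (1 / e)) powr e" using assms by (simp add: powr_powr)
        also have "\<dots> \<le> real p powr e"
          using le assms by (intro powr_mono2) auto
        finally show ?thesis .
      qed
      hence "2 ^ k \<le> (real p powr e) ^ k" by (intro power_mono) auto
      moreover have "real k + 1 \<le> 2 ^ k"
        using Bernoulli_inequality[of "1::real" k] by simp
      ultimately show ?thesis using B by (simp add: mult.commute mult_left_mono)
    qed
    have "real (card {d. d dvd p ^ k * n}) = (real k + 1) * real (card {d. d dvd n})"
      unfolding card by (simp add: distrib_right)
    also have "\<dots> \<le> (real k + 1) * (B ^ ?c n * real n powr e)"
      using prime_power_mult.IH by (intro mult_left_mono) auto
    also have "\<dots> = ((real k + 1) * B ^ ?c n) * real n powr e" by simp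
    also have "\<dots> \<le> (B ^ ?c (p ^ k * n) * (real p powr e) ^ k) * real n powr e"
      by (intro mult_right_mono main) auto
    finally show ?case by (simp only: pk mult.assoc)
  qed
  \<comment> \<open>Fewer than \<open>Q\<close> is the only restriction on the counted primes, so
    their number is bounded uniformly in \<open>m\<close>.\<close>
  moreover have "B ^ card {p \<in> prime_factors m. p < Q} \<le> B ^ Q" for m :: nat
  proof (rule power_increasing)
    have "card {p \<in> prime_factors m. p < Q} \<le> card {..<Q}" by (rule card_mono) auto
    thus "card {p \<in> prime_factors m. p < Q} \<le> Q" by simp
  qed (use B in auto)
  ultimately have "real (card {d. d dvd m}) \<le> B ^ Q * real m powr e" if "m > 0" for m
    using that by (meson mult_right_mono order_trans powr_ge_zero)
  with B show ?thesis by (intro that[of "B ^ Q"]) auto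
qed

section \<open>The Euler product for the divisor sum of the weight\<close>

text \<open>The Hardy--Littlewood prediction for \<open>R(2n)\<close>, without its factor \<open>2 C\<^sub>2 / log\<^sup>2 n\<close>.\<close>

definition hl_weight :: "nat \<Rightarrow> real" where
  "hl_weight n = real n * (\<Prod>p | p \<in> prime_factors n \<and> p > 2. (real p - 1) / (real p - 2))"

lemma hl_weight_ge: "hl_weight n \<ge> real n"
proof -
  have "1 \<le> (\<Prod>p | p \<in> prime_factors n \<and> p > 2. (real p - 1) / (real p - 2))"
    by (intro prod_ge_1) (auto simp: field_simps)
  thus ?thesis unfolding hl_weight_def by (simp add: mult_le_cancel_left1)
qed

lemma hl_weight_prime_power_mult:
  assumes "prime p" "\<not> p dvd n" "n > 0"
  shows "hl_weight (p ^ k * n) =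
    (if k > 0 \<and> p > 2 then (real p - 1) / (real p - 2) else 1) * real p ^ k * hl_weight n"
proof (cases "k > 0")
  case True
  have "{q \<in> prime_factors (p ^ k * n). q > 2} =
      (if p > 2 then insert p {q \<in> prime_factors n. q > 2} else {q \<in> prime_factors n. q > 2})"
    using prime_factors_prime_power_mult[OF assms(1,3) True] by auto
  thus ?thesis using True assms(2) by (simp add: hl_weight_def in_prime_factors_iff)
qed (simp add: hl_weight_def)

lemma J_prime_power_mult:
  assumes "prime p" "\<not> p dvd n" "n > 0" "k > 0"
  shows "J (p ^ k * n) =
    (if p > 2 then (1 - 2 / real p ^ (k + 1)) * inverse (1 - 2 / real p) else 2 - 1 / 2 ^ k) * J n"
proof -
  let ?S = "{q \<in> prime_factors n. q > 2}"
  let ?f = "\<lambda>m q. (1 - 2 / real q ^ (multiplicity q m + 1)) * inverse (1 - 2 / real q)"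
  have fac: "{q \<in> prime_factors (p ^ k * n). q > 2} = (if p > 2 then insert p ?S else ?S)"
    using prime_factors_prime_power_mult[OF assms(1,3,4)] by auto
  have "p \<notin> ?S" using assms(2) by auto
  have S: "prod (?f (p ^ k * n)) ?S = prod (?f n) ?S"
  proof (rule prod.cong)
    fix q assume "q \<in> ?S"
    with assms(1,2) have "multiplicity q (p ^ k * n) = multiplicity q n"
      by (intro multiplicity_other_prime_power_mult) (auto simp: in_prime_factors_iff)
    thus "?f (p ^ k * n) q = ?f n q" by simp
  qed simp
  have mp: "multiplicity p (p ^ k * n) = k"
    using assms by (intro multiplicity_prime_power_mult)
  show ?thesis
  proof (cases "p > 2")
    case True
    have "multiplicity 2 (p ^ k * n) = multiplicity 2 n"
      using assms True by (intro multiplicity_other_prime_power_mult) auto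
    thus ?thesis using True S \<open>p \<notin> ?S\<close> by (simp add: J_def fac mp)
  next
    case False
    with prime_ge_2_nat[OF assms(1)] have "p = 2" by simp
    moreover have "multiplicity 2 n = 0" using assms(2) \<open>p = 2\<close> by (simp add: not_dvd_imp_multiplicity_0)
    ultimately show ?thesis using S mp False unfolding J_def fac by simp
  qed
qed

text \<open>Both sides are multiplicative, so prime powers decide. For odd \<open>p\<close> the
  local sum is \<open>(p ^ (k + 1) - 2) / (p - 2)\<close>, for \<open>p = 2\<close> it is
  \<open>2 ^ (k + 1) - 1\<close>; dividing by \<open>p ^ k\<close> gives the local factors of
  \<open>J\<close>.\<close>

lemma sum_divisors_hl_weight:
  assumes "m > 0"
  shows "(\<Sum>d | d dvd m. hl_weight d) = real m * J m"
  using assms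
proof (induction rule: coprime_prime_power_induct)
  case one
  then show ?case by (simp add: hl_weight_def J_def)
next
  case (prime_power_mult p k n)
  note p = prime_power_mult(1,4,3)
  let ?g = "if p > 2 then (real p - 1) / (real p - 2) else 1"
  have p2: "real p \<ge> 2" using prime_ge_2_nat[OF p(1)] by simp
  have "(\<Sum>d | d dvd p ^ k * n. hl_weight d) =
      (\<Sum>j\<le>k. \<Sum>d | d dvd n. (if j > 0 then ?g else 1) * real p ^ j * hl_weight d)"
    unfolding sum_divisors_prime_power_mult[OF p]
    using p by (intro sum.cong refl) (subst hl_weight_prime_power_mult, auto dest: dvd_trans intro: dvd_pos_nat)
  also have "\<dots> = (\<Sum>j\<le>k. (if j > 0 then ?g else 1) * real p ^ j) * (real n * J n)"
    unfolding prime_power_mult.IH[symmetric] sum_product ..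
  \<comment> \<open>A geometric sum in which only the term \<open>j = 0\<close> escapes the factor
    \<open>?g\<close>.\<close>
  also have "(\<Sum>j\<le>k. (if j > 0 then ?g else 1) * real p ^ j) =
      1 + ?g * (real p * (real p ^ k - 1) / (real p - 1))"
    using p2 by (induction k) (auto simp: field_simps)
  also have "\<dots> = real p ^ k *
      (if p > 2 then (1 - 2 / real p ^ (k + 1)) * inverse (1 - 2 / real p) else 2 - 1 / 2 ^ k)"
  proof (cases "p > 2")
    case True
    define x y where "x = real p" and "y = real p ^ k"
    have xy: "x > 2" "y > 0" using True by (auto simp: x_def y_def)
    have "1 + (x - 1) / (x - 2) * (x * (y - 1) / (x - 1)) = (x * y - 2) / (x - 2)"
      using xy by (simp add: divide_simps) (simp add: algebra_simps)
    also have "\<dots> = y * ((1 - 2 / (x * y)) * inverse (1 - 2 / x))"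
      using xy by (simp add: divide_simps)
    finally show ?thesis using True by (simp add: x_def y_def)
  next
    case False
    with prime_ge_2_nat[OF p(1)] have "p = 2" by simp
    thus ?thesis by (simp add: field_simps)
  qed
  finally show ?case
    using J_prime_power_mult[OF p] prime_power_mult(2) by simp
qed

section \<open>Passing from a pointwise limit to divisor sums\<close>

text \<open>The lower bound uses only \<open>ln n \<le> ln m\<close> for divisors \<open>n\<close>
  of \<open>m\<close>. The upper bound needs the cutoff at \<open>m powr (1 - e)\<close> and the
  divisor bound.\<close>

lemma divisor_sum_log_limit:
  fixes b w :: "nat \<Rightarrow> real" and c :: real
  assumes w: "\<And>n. w n \<ge> real n"
    and b: "\<And>n. b n \<ge> 0" "\<And>n. b n \<le> K * real n"
    and lim: "(\<lambda>n. b n * (ln (real n))\<^sup>2 / w n) \<longlonglongrightarrow> c"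
  shows "(\<lambda>m. (\<Sum>n | n dvd m. b n) * (ln (real m))\<^sup>2 / (\<Sum>n | n dvd m. w n)) \<longlonglongrightarrow> c"
proof -
  have w0: "w n \<ge> 0" for n using w[of n] by linarith
  have S_ge: "(\<Sum>n | n dvd m. w n) \<ge> real m" if "m > 0" for m
    using member_le_sum[of m "{n. n dvd m}" w] w[of m] w0 that by auto
  have K: "K \<ge> 0" using b[of 1] by simp
  let ?T = "\<lambda>m. (\<Sum>n | n dvd m. b n) * (ln (real m))\<^sup>2 / (\<Sum>n | n dvd m. w n)"
  show ?thesis
  proof (rule order_tendstoI)
    fix a assume "a < c"
    then obtain a' where a': "a < a'" "a' < c" using dense by blast
    from order_tendstoD(1)[OF lim a'(2)] obtain N
      where N: "\<And>n. n \<ge> N \<Longrightarrow> a' < b n * (ln (real n))\<^sup>2 / w n"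
      by (auto simp: eventually_at_top_linorder)
    \<comment> \<open>\<open>L\<close> bounds the total loss from divisors below \<open>N\<close>,
      where the limit says nothing. It does not depend on \<open>m\<close>; the absolute value
      covers negative \<open>a'\<close>.\<close>
    define L where "L = (\<Sum>n<N. \<bar>a'\<bar> * w n)"
    have "L \<ge> 0" unfolding L_def using w0 by (intro sum_nonneg) auto
    have "a' - L / real m \<le> ?T m" if "m > 0" for m
    proof -
      let ?S = "\<Sum>n | n dvd m. w n"
      have fin: "finite {n. n dvd m}" using that by simp
      have "a' * w n - (if n < N then \<bar>a'\<bar> * w n else 0) \<le> b n * (ln (real m))\<^sup>2"
        if n: "n dvd m" for n
      proof (cases "n < N")
        case True
        have "a' * w n \<le> \<bar>a'\<bar> * w n" using w0 by (intro mult_right_mono) auto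
        moreover have "0 \<le> b n * (ln (real m))\<^sup>2" using b by simp
        ultimately show ?thesis using True by simp
      next
        case False
        have n1: "n \<ge> 1" "n \<le> m" using n \<open>m > 0\<close> by (auto intro: dvd_imp_le Suc_leI dvd_pos_nat)
        have "w n > 0" using w[of n] n1 by linarith
        hence "a' * w n \<le> b n * (ln (real n))\<^sup>2"
          using N[of n] False by (simp add: field_simps)
        also have "\<dots> \<le> b n * (ln (real m))\<^sup>2"
          using n1 b by (intro mult_left_mono power_mono) auto
        finally show ?thesis using False by simp
      qed
      hence "(\<Sum>n | n dvd m. a' * w n - (if n < N then \<bar>a'\<bar> * w n else 0))
          \<le> (\<Sum>n | n dvd m. b n * (ln (real m))\<^sup>2)"
        by (intro sum_mono) auto
      also have "(\<Sum>n | n dvd m. a' * w n - (if n < N then \<bar>a'\<bar> * w n else 0)) =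
          a' * ?S - (\<Sum>n | n dvd m. if n < N then \<bar>a'\<bar> * w n else 0)"
        by (simp add: sum_subtractf sum_distrib_left)
      finally have "a' * ?S \<le> (\<Sum>n | n dvd m. b n) * (ln (real m))\<^sup>2
          + (\<Sum>n | n dvd m. if n < N then \<bar>a'\<bar> * w n else 0)"
        by (simp add: sum_distrib_right)
      also have "(\<Sum>n | n dvd m. if n < N then \<bar>a'\<bar> * w n else 0) =
          (\<Sum>n \<in> {n. n dvd m} \<inter> {..<N}. \<bar>a'\<bar> * w n)"
        using fin by (simp add: sum.inter_restrict)
      also have "\<dots> \<le> L" unfolding L_def using w0 by (intro sum_mono2) auto
      finally have "a' * ?S \<le> (\<Sum>n | n dvd m. b n) * (ln (real m))\<^sup>2 + L" by simp
      moreover have Sp: "?S > 0" using S_ge[OF that] that by linarith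
      ultimately have "(a' - L / ?S) * ?S \<le> (\<Sum>n | n dvd m. b n) * (ln (real m))\<^sup>2"
        by (simp add: left_diff_distrib)
      hence "a' - L / ?S \<le> ?T m" using Sp by (simp add: pos_le_divide_eq)
      moreover have "L / ?S \<le> L / real m"
        using S_ge[OF that] that \<open>L \<ge> 0\<close> Sp by (intro divide_left_mono) auto
      ultimately show ?thesis by linarith
    qed
    note T_ge = this
    have "(\<lambda>m. a' - L / real m) \<longlonglongrightarrow> a'" by real_asymp
    hence "\<forall>\<^sub>F m in sequentially. a < a' - L / real m"
      using a'(1) by (rule order_tendstoD)
    thus "\<forall>\<^sub>F m in sequentially. a < ?T m"
      using eventually_gt_at_top[of 0] by eventually_elim (use T_ge less_le_trans in blast)
  next
    fix a assume "c < a"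
    \<comment> \<open>One small \<open>e\<close> serves twice: as the error in the limit and as the
      loss in the exponent of the cutoff, which costs the factor
      \<open>1 / (1 - e)\<^sup>2\<close>.\<close>
    have "((\<lambda>e. (c + e) / (1 - e)\<^sup>2) \<longlongrightarrow> (c + 0) / (1 - 0)\<^sup>2) (at_right (0::real))"
      by (intro tendsto_intros) auto
    hence "\<forall>\<^sub>F e in at_right 0. (c + e) / (1 - e)\<^sup>2 < a"
      using \<open>c < a\<close> by (intro order_tendstoD) auto
    moreover have "\<forall>\<^sub>F e in at_right 0. e < (1::real)"
      by (intro eventually_at_right_less order_tendstoD(2)[OF tendsto_ident_at]) auto
    moreover have "\<forall>\<^sub>F e in at_right 0. (e::real) > 0" by (rule eventually_at_right_less)
    ultimately have "\<forall>\<^sub>F e in at_right 0. (c + e) / (1 - e)\<^sup>2 < a \<and> e < 1 \<and> e > 0"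
      by eventually_elim auto
    then obtain e where e: "(c + e) / (1 - e)\<^sup>2 < a" "e < 1" "e > 0"
      using eventually_happens trivial_limit_at_right_real by (metis (no_types, lifting))
    from order_tendstoD(2)[OF lim, of "c + e"] e(3) obtain N
      where N: "\<And>n. n \<ge> N \<Longrightarrow> b n * (ln (real n))\<^sup>2 / w n < c + e"
      by (auto simp: eventually_at_top_linorder)
    \<comment> \<open>Half of the saving \<open>e\<close> pays for the number of divisors, so that
      \<open>?E m / m\<close> below is \<open>C * K * m powr (- e / 2) * (ln m)\<^sup>2\<close>,
      which tends to 0.\<close>
    obtain C where C: "C > 0" "\<And>m. m > 0 \<Longrightarrow> real (card {d. d dvd m}) \<le> C * real m powr (e / 2)"
      using card_divisors_bound[of "e / 2"] e(3) by auto
    define u where "u = (c + e) / (1 - e)\<^sup>2"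
    \<comment> \<open>This makes \<open>u\<close> nonnegative, so \<open>u * w n\<close> may be
      added to the bound for the small divisors too.\<close>
    have c: "c \<ge> 0"
      using b w0 by (intro tendsto_lowerbound[OF lim] always_eventually) auto
    let ?E = "\<lambda>m. C * real m powr (e / 2) * (K * real m powr (1 - e)) * (ln (real m))\<^sup>2"
    \<comment> \<open>The second condition on \<open>m\<close> forces every divisor beyond the
      cutoff to be at least \<open>N\<close>.\<close>
    have "?T m \<le> u + ?E m / real m" if m: "m > 1" "real N \<le> real m powr (1 - e)" for m
    proof -
      let ?S = "\<Sum>n | n dvd m. w n"
      let ?x = "real m powr (1 - e)"
      have lnm: "ln (real m) > 0" using m by simp
      have "b n * (ln (real m))\<^sup>2 \<le> K * ?x * (ln (real m))\<^sup>2 + u * w n" if n: "n dvd m" for n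
      proof (cases "real n \<le> ?x")
        case True
        have "b n \<le> K * ?x" using b(2)[of n] mult_left_mono[OF True K] by linarith
        moreover have "u * w n \<ge> 0" using c e w0 by (simp add: u_def)
        ultimately show ?thesis by (simp add: add_increasing2 mult_right_mono)
      next
        case False
        have "n > 0" using dvd_pos_nat[OF _ n] m by simp
        hence wn: "w n > 0" using w[of n] by linarith
        have "N \<le> n" using False m by linarith
        have "(1 - e) * ln (real m) = ln ?x" using m by (simp add: ln_powr)
        also have "\<dots> \<le> ln (real n)" using False m \<open>n > 0\<close> by (subst ln_le_cancel_iff) auto
        finally have "((1 - e) * ln (real m))\<^sup>2 \<le> (ln (real n))\<^sup>2"
          using e lnm by (intro power_mono) auto
        hence "b n * ((1 - e) * ln (real m))\<^sup>2 \<le> b n * (ln (real n))\<^sup>2"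
          using b by (intro mult_left_mono) auto
        also have "\<dots> \<le> (c + e) * w n"
          using N[OF \<open>N \<le> n\<close>] wn by (simp add: field_simps)
        finally have "b n * (ln (real m))\<^sup>2 \<le> u * w n"
          using e unfolding power_mult_distrib u_def by (simp add: pos_le_divide_eq mult_ac)
        thus ?thesis using K by (simp add: add_increasing)
      qed
      hence "(\<Sum>n | n dvd m. b n * (ln (real m))\<^sup>2)
          \<le> (\<Sum>n | n dvd m. K * ?x * (ln (real m))\<^sup>2 + u * w n)"
        by (intro sum_mono) auto
      hence "(\<Sum>n | n dvd m. b n) * (ln (real m))\<^sup>2
          \<le> real (card {d. d dvd m}) * (K * ?x * (ln (real m))\<^sup>2) + u * ?S"
        by (simp add: sum.distrib sum_distrib_left sum_distrib_right)
      also have "real (card {d. d dvd m}) * (K * ?x * (ln (real m))\<^sup>2) \<le>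
          C * real m powr (e / 2) * (K * ?x * (ln (real m))\<^sup>2)"
        using C(2)[of m] m K by (intro mult_right_mono) auto
      finally have "(\<Sum>n | n dvd m. b n) * (ln (real m))\<^sup>2 \<le> ?E m + u * ?S"
        by (simp add: mult_ac)
      moreover have Sp: "?S > 0" using S_ge[of m] m by linarith
      ultimately have "?T m \<le> (?E m + u * ?S) / ?S" by (intro divide_right_mono) auto
      also have "\<dots> = u + ?E m / ?S" using Sp by (simp add: add_divide_distrib)
      finally have "?T m \<le> u + ?E m / ?S" .
      moreover have "?E m / ?S \<le> ?E m / real m"
        using S_ge[of m] m K C Sp by (intro divide_left_mono) auto
      ultimately show ?thesis by linarith
    qed
    note T_le = this
    have "(\<lambda>m. u + ?E m / real m) \<longlonglongrightarrow> u" using e by real_asymp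
    hence "\<forall>\<^sub>F m in sequentially. u + ?E m / real m < a"
      using e(1) unfolding u_def by (rule order_tendstoD)
    moreover have "filterlim (\<lambda>m. real m powr (1 - e)) at_top sequentially"
      using e by real_asymp
    hence "\<forall>\<^sub>F m in sequentially. real N \<le> real m powr (1 - e)"
      by (simp add: filterlim_at_top)
    ultimately show "\<forall>\<^sub>F m in sequentially. ?T m < a"
      using eventually_gt_at_top[of 1] by eventually_elim (use T_le le_less_trans in blast)
  qed
qed

section \<open>Goldbach counts and the conclusion\<close>

text \<open>All factors are positive, so the limit is nonnegative; a convergent product without zero
  factors is nonzero. This permits division by \<open>2 * C2\<close> at the end.\<close>

lemma C2_pos: "C2 > 0"
proof -
  let ?f = "\<lambda>p. if prime p \<and> p > 2 then 1 - 1 / (real p - 1)\<^sup>2 else 1"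
  have "?f p > 0" for p
  proof (cases "p > 2")
    case True
    hence "1 < (real p - 1)\<^sup>2" by (intro one_less_power) auto
    thus ?thesis by simp
  qed auto
  note pos = this
  have "C2 \<ge> 0" unfolding C2_def
    by (rule tendsto_lowerbound[OF convergent_prod_LIMSEQ[OF convergent_C2]])
      (auto intro!: always_eventually prod_nonneg less_imp_le[OF pos] simp del: if_split)
  moreover have "C2 \<noteq> 0" unfolding C2_def
    
    using less_imp_neq[OF pos, THEN not_sym] by (rule prodinf_nonzero[OF convergent_C2])
  ultimately show ?thesis by simp
qed

text \<open>The summands \<open>n\<close> and \<open>d - n\<close> have opposite parity, so one of
  them is even and not an odd prime.\<close>

lemma goldbach_R_odd:
  assumes "odd d"
  shows "goldbach_R d = 0"
  unfolding goldbach_R_def chi_P_def odd_primes_def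
  using assms by (intro sum.neutral) (auto simp: indicator_def)

lemma goldbach_R_le: "goldbach_R N \<le> N"
proof -
  have "goldbach_R N \<le> (\<Sum>n = 1..N - 1. 1)"
    unfolding goldbach_R_def chi_P_def by (intro sum_mono) (auto simp: indicator_def)
  thus ?thesis by simp
qed

lemma goldbach_a_double:
  assumes "m > 0"
  shows "goldbach_a (2 * m) = (\<Sum>n | n dvd m. goldbach_R (2 * n))"
proof -
  have "goldbach_a (2 * m) = (\<Sum>d \<in> (*) 2 ` {n. n dvd m}. goldbach_R d)"
    unfolding goldbach_a_def
  proof (rule sum.mono_neutral_right)
    show "\<forall>d \<in> {d. d dvd 2 * m} - (*) 2 ` {n. n dvd m}. goldbach_R d = 0"
      by (auto intro!: goldbach_R_odd elim!: evenE)
  qed (use assms in auto)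
  thus ?thesis by (simp add: sum.reindex inj_on_def)
qed

theorem theorem3p4:
  assumes "(\<lambda>n. real (goldbach_R (2 * n))) \<sim>[at_top]
    (\<lambda>n. 2 * C2 * (real n / (ln (real n))\<^sup>2) *
      (\<Prod>p | p \<in> prime_factors n \<and> p > 2. (real p - 1) / (real p - 2)))"
  shows "(\<lambda>m. real (goldbach_a (2 * m))) \<sim>[at_top]
    (\<lambda>m. 2 * C2 * J m * real m / (ln (real m))\<^sup>2)"
proof -
  have nz: "\<forall>\<^sub>F n in at_top. hl_weight n > 0 \<and> ln (real n) > 0"
    using eventually_gt_at_top[of 1]
  proof eventually_elim
    case (elim n)
    thus ?case using hl_weight_ge[of n] by simp
  qed
  have R: "(\<lambda>n. real (goldbach_R (2 * n))) \<sim>[at_top] (\<lambda>n. 2 * C2 * hl_weight n / (ln (real n))\<^sup>2)"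
    using assms by (simp add: hl_weight_def mult_ac)
  \<comment> \<open>Multiplying by \<open>(ln n)\<^sup>2 / hl_weight n\<close> turns the equivalence
    into convergence to a constant, as \<open>divisor_sum_log_limit\<close> requires.\<close>
  have "(\<lambda>n. real (goldbach_R (2 * n)) * ((ln (real n))\<^sup>2 / hl_weight n)) \<sim>[at_top]
      (\<lambda>n. 2 * C2 * hl_weight n / (ln (real n))\<^sup>2 * ((ln (real n))\<^sup>2 / hl_weight n))"
    by (intro asymp_equiv_intros R)
  also have "\<dots> \<sim>[at_top] (\<lambda>_. 2 * C2)"
    by (intro asymp_equiv_refl_ev eventually_mono[OF nz]) auto
  finally have "(\<lambda>n. real (goldbach_R (2 * n)) * (ln (real n))\<^sup>2 / hl_weight n) \<longlonglongrightarrow> 2 * C2"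
    by (auto dest: asymp_equivD_const)
  hence lim: "(\<lambda>m. (\<Sum>n | n dvd m. real (goldbach_R (2 * n))) * (ln (real m))\<^sup>2
      / (\<Sum>n | n dvd m. hl_weight n)) \<longlonglongrightarrow> 2 * C2"
  proof (intro divisor_sum_log_limit hl_weight_ge)
    show "real (goldbach_R (2 * n)) \<le> 2 * real n" for n
      using goldbach_R_le[of "2 * n"] by linarith
  qed auto
  have "(\<lambda>m. real (goldbach_a (2 * m)) / (2 * C2 * J m * real m / (ln (real m))\<^sup>2))
      \<longlonglongrightarrow> 2 * C2 / (2 * C2)"
  \<comment> \<open>For \<open>m > 0\<close> the weight sum in \<open>lim\<close> equals
    \<open>m * J m\<close>, so the target quotient is the one in \<open>lim\<close> divided by
    \<open>2 * C2\<close>.\<close>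
  proof (rule Lim_transform_eventually)
    show "(\<lambda>m. (\<Sum>n | n dvd m. real (goldbach_R (2 * n))) * (ln (real m))\<^sup>2
      / (\<Sum>n | n dvd m. hl_weight n) / (2 * C2)) \<longlonglongrightarrow> 2 * C2 / (2 * C2)"
      using lim C2_pos by (intro tendsto_intros) auto
    show "\<forall>\<^sub>F m in sequentially. (\<Sum>n | n dvd m. real (goldbach_R (2 * n))) * (ln (real m))\<^sup>2
      / (\<Sum>n | n dvd m. hl_weight n) / (2 * C2) =
      real (goldbach_a (2 * m)) / (2 * C2 * J m * real m / (ln (real m))\<^sup>2)"
      using eventually_gt_at_top[of 0]
      by eventually_elim (simp add: goldbach_a_double[simplified] sum_divisors_hl_weight)
  qed
  thus ?thesis using C2_pos by (intro asymp_equivI') simp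
qed

end
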